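(* Let $p\in(0,1/2)$ be a fixed constant, and let $k=k(n)$ and $\delta=\delta(n)$ satisfy $k=o(n)$ and $\delta=o(1)$ as $n\to\infty$. Consider any (variable-length, adaptive) algorithm for computing $\mathsf{TH}_k(\mathbf{x})$ from noisy queries, and let $M$ denote the number of noisy queries it makes. If \[ \mathbb{E}[M\mid \mathbf{x}]\le (1-o(1))\,\frac{n\log\frac{k}{\delta}}{D_{\mathsf{KL}}(p\|1-p)} \] for every input instance $\mathbf{x}\in\{0,1\}^n$, then the worst-case error probability of the algorithm, $\max_{\mathbf{x}\in\{0,1\}^n}\mathbb{P}(\widehat{\mathsf{TH}}_k\neq \mathsf{TH}_k(\mathbf{x})\mid\mathbf{x})$, is at least $\delta$.
   Context: For $\mathbf{x}=(x_1,\dots,x_n)\in\{0,1\}^n$ and a positive integer $k$, the threshold-$k$ function is $\mathsf{TH}_k(\mathbf{x})=1$ if $\sum_{i=1}^n x_i\ge k$ and $\mathsf{TH}_k(\mathbf{x})=0$ otherwise. Noisy query model: at each time step the algorithm chooses an index $i\in[n]$ (possibly depending on all previous responses) and observes $x_i\oplus Z$, where $Z\sim\mathsf{Bern}(p)$ is independent of everything else; the crossover probability $p$ is known to the algorithm. A variable-length algorithm may decide adaptively when to stop (so $M$ is random), and then outputs an estimate $\widehat{\mathsf{TH}}_k\in\{0,1\}$. $D_{\mathsf{KL}}(p\|1-p)=(1-2p)\log\frac{1-p}{p}$ is the Kullback–Leibler divergence between $\mathsf{Bern}(p)$ and $\mathsf{Bern}(1-p)$; $\log$ is the natural logarithm.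 The $o(1)$ terms are with respect to $n\to\infty$. *)

theory Defs
  imports "HOL-Probability.Probability" "HOL-Library.Landau_Symbols"
begin

datatype action = Stop bool | Query nat

text \<open>A history is the list of (queried index, observed noisy bit).
  A (possibly randomized) variable-length adaptive algorithm is a policy that maps
  the history to a distribution over the next action.\<close>
type_synonym hist = "(nat \<times> bool) list"
type_synonym policy = "hist \<Rightarrow> action pmf"
type_synonym state = "hist \<times> bool option"

definition TH :: "nat \<Rightarrow> nat \<Rightarrow> (nat \<Rightarrow> bool) \<Rightarrow> bool" where
  "TH n k x = (k \<le> card {i. i < n \<and> x i})"

definition inputs :: "nat \<Rightarrow> (nat \<Rightarrow> bool) set" where
  "inputs n = {x. \<forall>i\<ge>n. \<not> x i}"

definition valid_policy :: "nat \<Rightarrow> policy \<Rightarrow> bool" where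
  "valid_policy n A = (\<forall>h. \<forall>a\<in>set_pmf (A h). \<forall>i. a = Query i \<longrightarrow> i < n)"

definition step :: "real \<Rightarrow> policy \<Rightarrow> (nat \<Rightarrow> bool) \<Rightarrow> state \<Rightarrow> state pmf" where
  "step p A x s = (case snd s of
      Some b \<Rightarrow> return_pmf s
    | None \<Rightarrow> bind_pmf (A (fst s)) (\<lambda>a. case a of
          Stop b \<Rightarrow> return_pmf (fst s, Some b)
        | Query i \<Rightarrow> map_pmf (\<lambda>z. (fst s @ [(i, x i \<noteq> z)], None)) (bernoulli_pmf p)))"

fun run :: "real \<Rightarrow> policy \<Rightarrow> (nat \<Rightarrow> bool) \<Rightarrow> nat \<Rightarrow> state pmf" where
  "run p A x 0 = return_pmf ([], None)"
| "run p A x (Suc t) = bind_pmf (run p A x t) (step p A x)"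

text \<open>E[M | x]: the number of queries made within t steps increases to M.\<close>
definition expected_queries :: "real \<Rightarrow> policy \<Rightarrow> (nat \<Rightarrow> bool) \<Rightarrow> ennreal" where
  "expected_queries p A x =
     (SUP t. \<integral>\<^sup>+ s. ennreal (real (length (fst s))) \<partial>measure_pmf (run p A x t))"

definition error_prob :: "real \<Rightarrow> nat \<Rightarrow> nat \<Rightarrow> policy \<Rightarrow> (nat \<Rightarrow> bool) \<Rightarrow> ennreal" where
  "error_prob p n k A x =
     (SUP t. emeasure (measure_pmf (run p A x t))
               {s. snd s \<noteq> None \<and> snd s \<noteq> Some (TH n k x)})"

definition worst_error :: "real \<Rightarrow> nat \<Rightarrow> nat \<Rightarrow> policy \<Rightarrow> ennreal" where
  "worst_error p n k A = Max (error_prob p n k A ` inputs n)"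

definition KL :: "real \<Rightarrow> real" where
  "KL p = (1 - 2 * p) * ln ((1 - p) / p)"

end

theory Submission
  imports Defs "HOL-Real_Asymp.Real_Asymp"
begin

text \<open>
  Let \<open>W\<^sub>j\<close> be the log-likelihood ratio of \<open>x\<^sub>j = 0\<close> against \<open>x\<^sub>j = 1\<close> in the transcript.
  For an input \<open>S\<close> with \<open>k\<close> ones and \<open>j \<in> S\<close>, weighting the law under \<open>S\<close> by \<open>exp W\<^sub>j\<close> gives
  the law under \<open>S - {j}\<close>, on which the correct answer is 0. Put \<open>a = (1 - \<epsilon>/2) log (k/\<delta>)\<close> and
  \<open>Z = (\<Sum>j\<in>S. exp W\<^sub>j 1(W\<^sub>j \<le> a))\<close>. The query budget forces \<open>W\<^sub>j \<le> a\<close> with probability bounded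
  away from 0 for an average pair of an input \<open>T\<close> with \<open>k - 1\<close> ones and \<open>j \<notin> T\<close>, by Wald's
  identity and Markov's inequality, so some \<open>S\<close> has \<open>E\<^sub>S[Z; answer 0] \<ge> c k\<close>. As
  \<open>E\<^sub>S[exp (W\<^sub>i + W\<^sub>j)] = 1\<close> for \<open>i \<noteq> j\<close> in \<open>S\<close>, also \<open>E\<^sub>S[Z\<^sup>2] \<le> k\<^sup>2 + k exp a\<close>. Cauchy-Schwarz
  bounds the error probability on \<open>S\<close> below by \<open>c\<^sup>2 / (1 + exp a / k)\<close>, which is of order at
  least \<open>c\<^sup>2 \<delta> powr (1 - \<epsilon>/2)\<close> and hence exceeds \<open>\<delta>\<close>. Finally \<open>\<epsilon>\<close> is sent to 0 diagonally.
\<close>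

section \<open>Diagonal sequences and double counting\<close>

lemma diagonal_null_sequence:
  fixes P :: "real \<Rightarrow> nat \<Rightarrow> bool"
  assumes "\<And>e. 0 < e \<Longrightarrow> e < 1 \<Longrightarrow> \<forall>\<^sub>F n in sequentially. P e n"
  shows "\<exists>\<epsilon>. \<epsilon> \<longlonglongrightarrow> 0 \<and> (\<forall>\<^sub>F n in sequentially. P (\<epsilon> n) n)"
proof -
  define e where "e m = 1 / (real m + 2)" for m :: nat
  define M where "M n = {m. m \<le> n \<and> (m = 0 \<or> P (e m) n)}" for n
  have M: "finite (M n)" "M n \<noteq> {}" for n
    unfolding M_def by auto
  have "eventually (\<lambda>n. m \<le> Max (M n)) sequentially" for m
  proof -
    have "eventually (\<lambda>n. P (e m) n) sequentially"
      by (rule assms) (auto simp: e_def)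
    then show ?thesis
      using eventually_ge_at_top[of m]
      by eventually_elim (intro Max_ge M, auto simp: M_def)
  qed
  then have lim: "filterlim (\<lambda>n. Max (M n)) at_top sequentially"
    unfolding filterlim_at_top by blast
  have "e \<longlonglongrightarrow> 0"
    unfolding e_def by real_asymp
  then have "(\<lambda>n. e (Max (M n))) \<longlonglongrightarrow> 0"
    using lim by (rule filterlim_compose)
  moreover have "\<forall>\<^sub>F n in sequentially. P (e (Max (M n))) n"
  proof -
    have "eventually (\<lambda>n. 1 \<le> Max (M n)) sequentially"
      using lim unfolding filterlim_at_top by blast
    then show ?thesis
    proof eventually_elim
      case (elim n)
      have "Max (M n) \<in> M n" by (rule Max_in[OF M])
      with elim show ?case by (simp add: M_def)
    qed
  qed
  ultimately show ?thesis by blast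
qed

text \<open>The pairs \<open>(S, j)\<close> with \<open>j \<in> S\<close> and \<open>(T, j)\<close>
  with \<open>j \<notin> T\<close> correspond under removing and inserting \<open>j\<close>.\<close>

lemma sum_remove_elem_reindex:
  fixes f :: "'a set \<Rightarrow> 'a \<Rightarrow> 'b::comm_monoid_add"
  assumes "finite U"
  shows "(\<Sum>S | S \<subseteq> U \<and> card S = Suc m. \<Sum>j\<in>S. f (S - {j}) j)
       = (\<Sum>T | T \<subseteq> U \<and> card T = m. \<Sum>j\<in>U - T. f T j)"
proof -
  have fin: "finite {S. S \<subseteq> U \<and> Q S}" for Q using assms by simp
  have finS: "S \<subseteq> U \<Longrightarrow> finite S" for S using assms finite_subset by blast
  have "(\<Sum>S | S \<subseteq> U \<and> card S = Suc m. \<Sum>j\<in>S. f (S - {j}) j)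
      = (\<Sum>(S, j)\<in>Sigma {S. S \<subseteq> U \<and> card S = Suc m} (\<lambda>S. S). f (S - {j}) j)"
    by (rule sum.Sigma) (use fin finS in auto)
  also have "\<dots> = (\<Sum>(T, j)\<in>Sigma {T. T \<subseteq> U \<and> card T = m} (\<lambda>T. U - T). f T j)"
    by (rule sum.reindex_bij_witness[of _ "\<lambda>(T, j). (insert j T, j)" "\<lambda>(S, j). (S - {j}, j)"])
      (use finS in \<open>auto simp: insert_absorb\<close>)
  also have "\<dots> = (\<Sum>T | T \<subseteq> U \<and> card T = m. \<Sum>j\<in>U - T. f T j)"
    by (rule sum.Sigma[symmetric]) (use fin finS assms in auto)
  finally show ?thesis .
qed

section \<open>Query counts and log-likelihood ratios\<close>

definition query_count :: "nat \<Rightarrow> hist \<Rightarrow> nat" where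
  "query_count j h = length (filter (\<lambda>q. fst q = j) h)"

text \<open>Log-likelihood ratio of \<open>x\<^sub>j = 0\<close> against \<open>x\<^sub>j = 1\<close>.\<close>
definition llr :: "real \<Rightarrow> nat \<Rightarrow> hist \<Rightarrow> real" where
  "llr p j h = (\<Sum>(i, b)\<leftarrow>h. if i = j then (if b then - 1 else 1) * ln ((1 - p) / p) else 0)"

lemma llr_simps [simp]:
  "llr p j [] = 0"
  "llr p j (h @ [(i, b)]) =
     llr p j h + (if i = j then (if b then - 1 else 1) * ln ((1 - p) / p) else 0)"
  by (simp_all add: llr_def)

lemma query_count_simps [simp]:
  "query_count j [] = 0"
  "query_count j (h @ [(i, b)]) = query_count j h + (if i = j then 1 else 0)"
  by (simp_all add: query_count_def)

lemma sum_query_count_le: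
  assumes "finite J"
  shows "(\<Sum>j\<in>J. query_count j h) \<le> length h"
proof (induction h rule: rev_induct)
  case (snoc q h)
  have "(\<Sum>j\<in>J. if fst q = j then 1 else 0) \<le> (1::nat)"
    using assms by simp
  with snoc show ?case
    by (cases q) (simp add: sum.distrib)
qed simp

lemma finite_inputs: "finite (inputs n)"
proof (rule finite_subset)
  show "inputs n \<subseteq> (\<lambda>S i. i \<in> S) ` Pow {..<n}"
  proof
    fix x assume "x \<in> inputs n"
    then have "Collect x \<subseteq> {..<n}"
      unfolding inputs_def using not_le by blast
    then show "x \<in> (\<lambda>S i. i \<in> S) ` Pow {..<n}"
      by (intro image_eqI[of _ _ "Collect x"]) simp_all
  qed
qed simp

section \<open>Finite-horizon expectations\<close>

locale noisy_algorithm =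
  fixes p :: real and n :: nat and A :: policy
  assumes p: "0 < p" "p < 1/2" and valid: "valid_policy n A"
begin

text \<open>Inputs are coded by their sets of ones, so that flipping bit \<open>j\<close> from 1 to
  0 is \<open>S - {j}\<close>.\<close>

abbreviation dist :: "nat \<Rightarrow> nat set \<Rightarrow> state pmf" where
  "dist t S \<equiv> run p A (\<lambda>i. i \<in> S) t"

abbreviation expect :: "nat \<Rightarrow> nat set \<Rightarrow> (state \<Rightarrow> real) \<Rightarrow> real" where
  "expect t S \<equiv> measure_pmf.expectation (dist t S)"

text \<open>Validity leaves finitely many actions, hence finite support at every time, and all
  expectations below are finite sums.\<close>

lemma finite_actions: "finite (set_pmf (A h))"
proof (rule finite_subset)
  show "set_pmf (A h) \<subseteq> range Stop \<union> Query ` {..<n}"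
  proof
    fix a assume "a \<in> set_pmf (A h)"
    with valid show "a \<in> range Stop \<union> Query ` {..<n}"
      by (cases a) (auto simp: valid_policy_def)
  qed
qed simp

lemma finite_step: "finite (set_pmf (step p A x s))"
  by (auto simp: step_def finite_actions split: option.splits action.splits)

lemma finite_run: "finite (set_pmf (run p A x t))"
  by (induction t) (auto simp: finite_step)

lemma integrable_run [simp]: "integrable (measure_pmf (run p A x t)) (f :: state \<Rightarrow> real)"
  by (rule integrable_measure_pmf_finite[OF finite_run])

lemma expect_mono:
  assumes "\<And>s. f s \<le> g s"
  shows "expect t S f \<le> expect t S g"
  using assms by (intro integral_mono) auto

lemma expect_Suc:
  "expect (Suc t) S f = expect t S (\<lambda>s. measure_pmf.expectation (step p A (\<lambda>i. i \<in> S) s) f)"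
proof -
  have "expect (Suc t) S f = (\<Sum>s\<in>set_pmf (dist t S). pmf (dist t S) s *\<^sub>R
      measure_pmf.expectation (step p A (\<lambda>i. i \<in> S) s) f)"
    unfolding run.simps by (rule pmf_expectation_bind[OF finite_run finite_step order_refl])
  then show ?thesis
    by (simp add: integral_measure_pmf[OF finite_run])
qed

lemma expectation_step_Some [simp]:
  "measure_pmf.expectation (step p A x (h, Some b)) (f :: state \<Rightarrow> real) = f (h, Some b)"
  by (simp add: step_def)

lemma expectation_step_None:
  "measure_pmf.expectation (step p A x (h, None)) (f :: state \<Rightarrow> real) =
     measure_pmf.expectation (A h) (\<lambda>a. case a of
         Stop b \<Rightarrow> f (h, Some b)
       | Query i \<Rightarrow> (1 - p) * f (h @ [(i, x i)], None) + p * f (h @ [(i, \<not> x i)], None))"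
proof -
  let ?K = "\<lambda>a. case a of Stop b \<Rightarrow> return_pmf (h, Some b)
        | Query i \<Rightarrow> map_pmf (\<lambda>z. (h @ [(i, x i \<noteq> z)], None)) (bernoulli_pmf p)"
  have "measure_pmf.expectation (step p A x (h, None)) f =
      (\<Sum>a\<in>set_pmf (A h). pmf (A h) a *\<^sub>R measure_pmf.expectation (?K a) f)"
    unfolding step_def fst_conv snd_conv option.case
    by (rule pmf_expectation_bind[OF finite_actions _ order_refl]) (auto split: action.splits)
  also have "\<dots> = measure_pmf.expectation (A h) (\<lambda>a. measure_pmf.expectation (?K a) f)"
    by (simp add: integral_measure_pmf[OF finite_actions])
  also have "(\<lambda>a. measure_pmf.expectation (?K a) f) = (\<lambda>a. case a of
         Stop b \<Rightarrow> f (h, Some b)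
       | Query i \<Rightarrow> (1 - p) * f (h @ [(i, x i)], None) + p * f (h @ [(i, \<not> x i)], None))"
    using p by (intro ext) (simp add: mult.commute split: action.splits)
  finally show ?thesis .
qed

section \<open>Change of measure and Wald's identity\<close>

text \<open>For \<open>j \<in> S\<close>, a query of \<open>j\<close> returns True with probability
  \<open>1 - p\<close> and multiplies the weight by \<open>p / (1 - p)\<close>; the product
  \<open>p\<close> is the probability of True once \<open>j\<close> is removed. False is symmetric,
  and other actions have the same law under both inputs.\<close>

lemma exp_llr_step:
  assumes "j \<in> S"
  shows "measure_pmf.expectation (step p A (\<lambda>i. i \<in> S) s) (\<lambda>s. f s * exp (llr p j (fst s)))
       = exp (llr p j (fst s)) * measure_pmf.expectation (step p A (\<lambda>i. i \<in> S - {j}) s) f"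
proof (cases s)
  case (Pair h r)
  have e: "exp (ln ((1 - p) / p)) = (1 - p) / p" "exp (- ln ((1 - p) / p)) = p / (1 - p)"
    using p by (auto simp: exp_minus)
  show ?thesis
  proof (cases r)
    case None
    show ?thesis
      unfolding Pair None expectation_step_None integral_mult_right_zero[symmetric]
      using p assms
      by (intro arg_cong[where f = "measure_pmf.expectation (A h)"] ext)
        (auto simp: exp_add e divide_simps split: action.splits, simp_all add: algebra_simps)
  qed (simp add: Pair)
qed

lemma change_of_measure:
  assumes "j \<in> S"
  shows "expect t S (\<lambda>s. f s * exp (llr p j (fst s))) = expect t (S - {j}) f"
\<comment> \<open>\<open>f\<close> must vary: the last step turns it into its conditional
  expectation under \<open>S - {j}\<close>.\<close>
proof (induction t arbitrary: f)
  case (Suc t)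
  show ?case
    unfolding expect_Suc exp_llr_step[OF assms]
    by (subst mult.commute) (rule Suc.IH)
qed simp

text \<open>The difference \<open>?f\<close> is a martingale: with \<open>x j = 0\<close>, each
  query of \<open>j\<close> has mean increment \<open>(1 - p) - p\<close> times
  \<open>ln ((1 - p) / p)\<close>, which is \<open>KL p\<close>.\<close>

lemma llr_wald:
  assumes "j \<notin> S"
  shows "expect t S (\<lambda>s. llr p j (fst s)) = KL p * expect t S (\<lambda>s. real (query_count j (fst s)))"
proof -
  let ?f = "\<lambda>s :: state. llr p j (fst s) - KL p * real (query_count j (fst s))"
  have step: "measure_pmf.expectation (step p A (\<lambda>i. i \<in> S) s) ?f = ?f s" for s
  proof (cases s)
    case (Pair h r)
    show ?thesis
    proof (cases r)
      case None
      have "measure_pmf.expectation (step p A (\<lambda>i. i \<in> S) s) ?f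
          = measure_pmf.expectation (A h) (\<lambda>a. ?f s)"
        unfolding Pair None expectation_step_None using assms
        by (intro arg_cong[where f = "measure_pmf.expectation (A h)"] ext)
          (auto simp: KL_def algebra_simps split: action.splits)
      then show ?thesis by simp
    qed (simp add: Pair)
  qed
  have "expect t S ?f = 0"
  proof (induction t)
    case (Suc t)
    then show ?case unfolding expect_Suc step .
  qed simp
  then show ?thesis by simp
qed

text \<open>The change of measure is read backwards, from \<open>T\<close> to
  \<open>insert j T\<close>, where the two weights cancel.\<close>

lemma expect_exp_neg_llr:
  assumes "j \<notin> T"
  shows "expect t T (\<lambda>s. exp (- llr p j (fst s))) = 1"
proof -
  have "expect t T (\<lambda>s. exp (- llr p j (fst s)))
      = expect t (insert j T) (\<lambda>s. exp (- llr p j (fst s)) * exp (llr p j (fst s)))"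
    using assms by (subst change_of_measure) auto
  then show ?thesis by (simp flip: exp_add)
qed

text \<open>Markov's inequality for the positive part of the log-likelihood ratio; its negative
  part has expectation at most 1 because \<open>max 0 (- w) \<le> exp (- w)\<close>.\<close>
lemma llr_tail:
  assumes "j \<notin> T" "0 < a"
  shows "expect t T (\<lambda>s. of_bool (a < llr p j (fst s)))
       \<le> (KL p * expect t T (\<lambda>s. real (query_count j (fst s))) + 1) / a"
proof -
  have "a * of_bool (a < w) \<le> w + exp (- w)" for w
  proof (cases "a < w")
    case True
    then show ?thesis using exp_gt_zero[of "- w"] by (simp del: exp_gt_zero)
  next
    case False
    then show ?thesis using exp_ge_add_one_self[of "- w"] by simp
  qed
  then have "expect t T (\<lambda>s. a * of_bool (a < llr p j (fst s)))
      \<le> expect t T (\<lambda>s. llr p j (fst s) + exp (- llr p j (fst s)))"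
    by (rule expect_mono)
  also have "\<dots> = KL p * expect t T (\<lambda>s. real (query_count j (fst s))) + 1"
    using assms(1) by (simp add: llr_wald expect_exp_neg_llr)
  finally show ?thesis
    using assms(2) by (simp add: field_simps)
qed

section \<open>Cutting the run off at a finite time\<close>

lemma running_length:
  "s \<in> set_pmf (run p A x t) \<Longrightarrow> snd s = None \<Longrightarrow> length (fst s) = t"
proof (induction t arbitrary: s)
  case (Suc t)
  then obtain h r where r: "(h, r) \<in> set_pmf (run p A x t)" "s \<in> set_pmf (step p A x (h, r))"
    by auto
  then have "r = None" using Suc.prems(2) by (cases r) (auto simp: step_def)
  from r(2) obtain a where "s \<in> set_pmf (case a of Stop b \<Rightarrow> return_pmf (h, Some b)
      | Query i \<Rightarrow> map_pmf (\<lambda>z. (h @ [(i, x i \<noteq> z)], None)) (bernoulli_pmf p))"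
    unfolding step_def fst_conv snd_conv \<open>r = None\<close> option.case set_bind_pmf by blast
  then show ?case using Suc.prems(2) Suc.IH[OF r(1)] \<open>r = None\<close> by (cases a) auto
qed simp

text \<open>Markov's inequality: a run that has not stopped by time \<open>t\<close> has made
  exactly \<open>t\<close> queries.\<close>

lemma running_prob:
  assumes "0 < t"
  shows "expect t S (\<lambda>s. of_bool (snd s = None)) \<le> expect t S (\<lambda>s. real (length (fst s))) / t"
proof -
  have "expect t S (\<lambda>s. t * of_bool (snd s = None)) \<le> expect t S (\<lambda>s. real (length (fst s)))"
    by (intro integral_mono_AE) (auto simp: AE_measure_pmf_iff dest: running_length)
  then show ?thesis using assms by (simp add: field_simps)
qed

section \<open>Second moment of truncated likelihood ratios\<close>

definition trunc_lr :: "real \<Rightarrow> nat \<Rightarrow> state \<Rightarrow> real" where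
  "trunc_lr a j s = of_bool (llr p j (fst s) \<le> a) * exp (llr p j (fst s))"

text \<open>On the diagonal, one factor is at most \<open>exp a\<close> and the other has mean at
  most 1. Off the diagonal both truncations are dropped, and two changes of measure give 1.\<close>

lemma trunc_lr_second_moment:
  assumes "finite S"
  shows "expect t S (\<lambda>s. (\<Sum>j\<in>S. trunc_lr a j s)\<^sup>2) \<le> real (card S) ^ 2 + real (card S) * exp a"
proof -
  have le: "trunc_lr a j s \<le> exp (llr p j (fst s))" "0 \<le> trunc_lr a j s" for j s
    by (auto simp: trunc_lr_def)
  have diag: "expect t S (\<lambda>s. trunc_lr a j s * trunc_lr a j s) \<le> exp a" if "j \<in> S" for j
  proof -
    have "expect t S (\<lambda>s. trunc_lr a j s * trunc_lr a j s)
        \<le> expect t S (\<lambda>s. exp a * exp (llr p j (fst s)))"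
      by (intro expect_mono mult_mono le) (auto simp: trunc_lr_def)
    also have "\<dots> = exp a" by (subst change_of_measure[OF that]) simp
    finally show ?thesis .
  qed
  have off: "expect t S (\<lambda>s. trunc_lr a i s * trunc_lr a j s) \<le> 1"
    if "i \<in> S" "j \<in> S" "i \<noteq> j" for i j
  proof -
    have "expect t S (\<lambda>s. trunc_lr a i s * trunc_lr a j s)
        \<le> expect t S (\<lambda>s. exp (llr p i (fst s)) * exp (llr p j (fst s)))"
      by (intro expect_mono mult_mono le) auto
    also have "\<dots> = expect t (S - {j}) (\<lambda>s. 1 * exp (llr p i (fst s)))"
      by (subst change_of_measure[OF that(2)]) simp
    also have "\<dots> = 1" using that by (subst change_of_measure) auto
    finally show ?thesis .
  qed
  have "expect t S (\<lambda>s. (\<Sum>j\<in>S. trunc_lr a j s)\<^sup>2)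
      = (\<Sum>i\<in>S. \<Sum>j\<in>S. expect t S (\<lambda>s. trunc_lr a i s * trunc_lr a j s))"
    by (simp add: power2_eq_square sum_product)
  also have "\<dots> \<le> (\<Sum>i\<in>S. \<Sum>j\<in>S. 1 + (if i = j then exp a else 0))"
    using diag off by (intro sum_mono) (auto intro: order_trans[OF diag])
  also have "\<dots> = real (card S) ^ 2 + real (card S) * exp a"
    using assms by (simp add: sum.distrib power2_eq_square distrib_left)
  finally show ?thesis .
qed

lemma accept_zero_prob:
  fixes c :: real
  assumes "finite S" "S \<noteq> {}" "0 < c"
    and mean: "c * card S \<le> expect t S (\<lambda>s. of_bool (snd s = Some False) * (\<Sum>j\<in>S. trunc_lr a j s))"
  shows "c\<^sup>2 / (1 + exp a / card S) \<le> expect t S (\<lambda>s. of_bool (snd s = Some False))"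
proof -
  let ?k = "real (card S)"
  let ?Z = "\<lambda>s. \<Sum>j\<in>S. trunc_lr a j s"
  let ?P = "expect t S (\<lambda>s. of_bool (snd s = Some False))"
  define V where "V = ?k\<^sup>2 + ?k * exp a"
  \<comment> \<open>Cauchy-Schwarz is used as a weighted AM-GM inequality; this weight makes
    \<open>V / l\<close> equal to \<open>c * ?k\<close>, half of the left-hand side.\<close>
  define l where "l = V / (c * ?k)"
  have k: "0 < ?k" using assms by (simp add: card_gt_0_iff)
  have V: "0 < V" unfolding V_def using k by (simp add: add_pos_pos)
  have l: "0 < l" unfolding l_def using V k assms by simp
  have amgm: "2 * (of_bool b * z) \<le> l * of_bool b + z\<^sup>2 / l" for b and z :: real
  proof -
    have "0 \<le> (l - z)\<^sup>2 / l" using l by simp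
    also have "\<dots> = l + z\<^sup>2 / l - 2 * z" using l by (simp add: power2_eq_square field_simps)
    finally show ?thesis using l by (cases b) auto
  qed
  have "2 * (c * ?k) \<le> expect t S (\<lambda>s. 2 * (of_bool (snd s = Some False) * ?Z s))"
    using mean by simp
  also have "\<dots> \<le> expect t S (\<lambda>s. l * of_bool (snd s = Some False) + (?Z s)\<^sup>2 / l)"
    by (intro expect_mono amgm)
  also have "\<dots> = l * ?P + expect t S (\<lambda>s. (?Z s)\<^sup>2) / l"
    by simp
  also have "\<dots> \<le> l * ?P + V / l"
    using trunc_lr_second_moment[OF assms(1), of t a] l
    by (intro add_left_mono divide_right_mono) (auto simp: V_def)
  also have "V / l = c * ?k" unfolding l_def using V by simp
  finally have "c * ?k / l \<le> ?P" using l by (simp add: field_simps)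
  moreover have "c * ?k / l = c\<^sup>2 / (1 + exp a / ?k)"
  proof -
    have "V = ?k\<^sup>2 * (1 + exp a / ?k)"
      unfolding V_def using k by (simp add: field_simps power2_eq_square)
    then show ?thesis
      unfolding l_def using k by (simp add: power2_eq_square)
  qed
  ultimately show ?thesis by simp
qed

section \<open>Averaging over inputs with \<open>m\<close> and \<open>m + 1\<close> ones\<close>

text \<open>For each \<open>T\<close> with \<open>m\<close> ones, all \<open>j\<close> outside
  \<open>T\<close> share the query budget \<open>B\<close>, which bounds the row sum of
  \<open>?g T j\<close> below. Regrouping the pairs by \<open>S = insert j T\<close> and averaging
  yields one \<open>S\<close> fit for \<open>accept_zero_prob\<close>.\<close>

lemma exists_input_accepting_zero:
  fixes B d c a :: real
  assumes "Suc m \<le> n" "0 < t" "0 < a" "0 < c"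
    and len: "\<And>S. S \<subseteq> {..<n} \<Longrightarrow> expect t S (\<lambda>s. real (length (fst s))) \<le> B"
    and err: "\<And>T. T \<subseteq> {..<n} \<Longrightarrow> card T = m \<Longrightarrow> expect t T (\<lambda>s. of_bool (snd s = Some True)) \<le> d"
    and c: "c * (n - m) \<le> (n - m) * (1 - d - B / t - 1 / a) - KL p * B / a"
  obtains S where "S \<subseteq> {..<n}" "card S = Suc m"
    "c\<^sup>2 / (1 + exp a / Suc m) \<le> expect t S (\<lambda>s. of_bool (snd s = Some False))"
proof -
  let ?F = "\<lambda>S. expect t S (\<lambda>s. of_bool (snd s = Some False) * (\<Sum>j\<in>S. trunc_lr a j s))"
  let ?g = "\<lambda>T j. expect t T (\<lambda>s. of_bool (snd s = Some False) * of_bool (llr p j (fst s) \<le> a))"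
  let ?U = "{..<n}"
  let ?SS = "{S. S \<subseteq> ?U \<and> card S = Suc m}" and ?TT = "{T. T \<subseteq> ?U \<and> card T = m}"
  have KL: "0 \<le> KL p" unfolding KL_def using p by (intro mult_nonneg_nonneg ln_ge_zero) auto
  have finU: "S \<subseteq> ?U \<Longrightarrow> finite S" for S using finite_subset by blast
  have finSS: "finite ?SS" by simp
  have F: "?F S = (\<Sum>j\<in>S. ?g (S - {j}) j)" for S
  proof -
    have "?F S = (\<Sum>j\<in>S. expect t S (\<lambda>s. of_bool (snd s = Some False) * of_bool (llr p j (fst s) \<le> a)
        * exp (llr p j (fst s))))"
      by (simp add: sum_distrib_left trunc_lr_def mult.assoc)
    then show ?thesis by (simp add: change_of_measure)
  qed
  have row: "c * (n - m) \<le> (\<Sum>j\<in>?U - T. ?g T j)" if T: "T \<in> ?TT" for T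
  proof -
    let ?N = "\<lambda>j. expect t T (\<lambda>s. real (query_count j (fst s)))"
    have cardUT: "card (?U - T) = n - m"
      using T finU by (subst card_Diff_subset) auto
    have B: "expect t T (\<lambda>s. real (length (fst s))) \<le> B" using T len by blast
    have g: "1 - d - B / t - (KL p * ?N j + 1) / a \<le> ?g T j" if j: "j \<in> ?U - T" for j
    proof -
      \<comment> \<open>Union bound: the event fails only through output True, a run still going, or
        a large ratio. These cost \<open>d\<close>, \<open>B / t\<close> and the bound of
        \<open>llr_tail\<close>.\<close>
      have "of_bool (r = Some False) * of_bool (w \<le> a)
          \<ge> 1 - of_bool (r = Some True) - of_bool (r = None) - (of_bool (a < w) :: real)"
        for r :: "bool option" and w
        by (cases r) (auto simp: of_bool_def)
      then have "expect t T (\<lambda>s. 1 - of_bool (snd s = Some True) - of_bool (snd s = None)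
          - of_bool (a < llr p j (fst s))) \<le> ?g T j"
        by (rule expect_mono)
      then have "1 - expect t T (\<lambda>s. of_bool (snd s = Some True))
          - expect t T (\<lambda>s. of_bool (snd s = None))
          - expect t T (\<lambda>s. of_bool (a < llr p j (fst s))) \<le> ?g T j"
        by simp
      moreover have "expect t T (\<lambda>s. of_bool (snd s = None)) \<le> B / t"
        using running_prob[OF assms(2), of T] divide_right_mono[OF B, of t] by simp
      moreover have "expect t T (\<lambda>s. of_bool (a < llr p j (fst s))) \<le> (KL p * ?N j + 1) / a"
        using j by (intro llr_tail assms) auto
      moreover have "expect t T (\<lambda>s. of_bool (snd s = Some True)) \<le> d"
        using T err by blast
      ultimately show ?thesis by linarith
    qed
    have "(\<Sum>j\<in>?U - T. ?N j) = expect t T (\<lambda>s. \<Sum>j\<in>?U - T. real (query_count j (fst s)))"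
      by simp
    also have "\<dots> \<le> expect t T (\<lambda>s. real (length (fst s)))"
      by (intro expect_mono) (metis finite_Diff finite_lessThan of_nat_le_iff of_nat_sum sum_query_count_le)
    finally have N: "(\<Sum>j\<in>?U - T. ?N j) \<le> B" using B by simp
    have "c * (n - m) \<le> (n - m) * (1 - d - B / t - 1 / a) - KL p * B / a" by (rule c)
    also have "\<dots> \<le> (n - m) * (1 - d - B / t - 1 / a) - KL p * (\<Sum>j\<in>?U - T. ?N j) / a"
      using N KL assms(3) by (intro diff_left_mono divide_right_mono mult_left_mono) auto
    also have "\<dots> = (\<Sum>j\<in>?U - T. (1 - d - B / t - 1 / a) - KL p * ?N j / a)"
      by (simp add: sum_subtractf cardUT sum_distrib_left sum_divide_distrib)
    also have "\<dots> = (\<Sum>j\<in>?U - T. 1 - d - B / t - (KL p * ?N j + 1) / a)"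
      by (intro sum.cong) (auto simp: add_divide_distrib)
    also have "\<dots> \<le> (\<Sum>j\<in>?U - T. ?g T j)"
      by (intro sum_mono g)
    finally show ?thesis .
  qed
  \<comment> \<open>The same reindexing with constant summand 1 converts \<open>c * (n - m)\<close>
    per \<open>T\<close> into \<open>c * Suc m\<close> per \<open>S\<close>.\<close>
  have count: "real (card ?TT) * (n - m) = real (card ?SS) * Suc m"
  proof -
    have "(\<Sum>S\<in>?SS. \<Sum>j\<in>S. 1::nat) = (\<Sum>T\<in>?TT. \<Sum>j\<in>?U - T. 1)"
      by (rule sum_remove_elem_reindex) simp
    moreover have "(\<Sum>T\<in>?TT. \<Sum>j\<in>?U - T. 1) = card ?TT * (n - m)"
    proof -
      have "(\<Sum>j\<in>?U - T. 1) = n - m" if "T \<in> ?TT" for T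
        using that finU by (simp add: card_Diff_subset)
      then have "(\<Sum>T\<in>?TT. \<Sum>j\<in>?U - T. 1) = (\<Sum>T\<in>?TT. n - m)" by (rule sum.cong[OF refl])
      then show ?thesis by simp
    qed
    moreover have "(\<Sum>S\<in>?SS. \<Sum>j\<in>S. 1::nat) = card ?SS * Suc m"
      by simp
    ultimately have "card ?TT * (n - m) = card ?SS * Suc m" by linarith
    then show ?thesis unfolding of_nat_mult[symmetric] by (rule arg_cong[where f = real])
  qed
  have "(\<Sum>S\<in>?SS. c * Suc m) = real (card ?SS) * Suc m * c" by simp
  also have "\<dots> = (\<Sum>T\<in>?TT. c * (n - m))" unfolding count[symmetric] by simp
  also have "\<dots> \<le> (\<Sum>T\<in>?TT. \<Sum>j\<in>?U - T. ?g T j)" by (intro sum_mono row)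
  also have "\<dots> = (\<Sum>S\<in>?SS. ?F S)" unfolding F
    by (rule sum_remove_elem_reindex[symmetric]) simp
  finally have le: "(\<Sum>S\<in>?SS. c * Suc m) \<le> (\<Sum>S\<in>?SS. ?F S)" .
  have "{..<Suc m} \<in> ?SS"
    using assms(1) by auto
  then have ne: "?SS \<noteq> {}" by blast
  have "\<exists>S\<in>?SS. c * Suc m \<le> ?F S"
  proof (rule ccontr)
    assume "\<not> ?thesis"
    then have "(\<Sum>S\<in>?SS. ?F S) < (\<Sum>S\<in>?SS. c * Suc m)"
      by (intro sum_strict_mono finSS ne) (simp add: not_le)
    with le show False by linarith
  qed
  then obtain S where S: "S \<subseteq> ?U" "card S = Suc m" "c * card S \<le> ?F S" by auto
  show thesis
  proof (rule that[OF S(1,2)])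
    have "c\<^sup>2 / (1 + exp a / card S) \<le> expect t S (\<lambda>s. of_bool (snd s = Some False))"
      using S assms(4) finU by (intro accept_zero_prob) auto
    then show "c\<^sup>2 / (1 + exp a / Suc m) \<le> expect t S (\<lambda>s. of_bool (snd s = Some False))"
      by (simp only: S(2))
  qed
qed

section \<open>Transfer to worst-case error and query budget\<close>

lemma set_in_inputs: "S \<subseteq> {..<n} \<Longrightarrow> (\<lambda>i. i \<in> S) \<in> inputs n"
  by (auto simp: inputs_def)

lemma TH_set: "S \<subseteq> {..<n} \<Longrightarrow> TH n k (\<lambda>i. i \<in> S) = (k \<le> card S)"
  unfolding TH_def by (rule arg_cong[where f = "\<lambda>S. k \<le> card S"]) auto

text \<open>The error is a supremum over times, so a wrong answer \<open>b\<close> at any one time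
  bounds it from below.\<close>

lemma expect_le_worst_error:
  assumes "S \<subseteq> {..<n}" "b \<noteq> (k \<le> card S)"
  shows "ennreal (expect t S (\<lambda>s. of_bool (snd s = Some b))) \<le> worst_error p n k A"
proof -
  have "(\<lambda>s. of_bool (snd s = Some b)) = (indicator {s :: state. snd s = Some b} :: _ \<Rightarrow> real)"
    by (auto simp: indicator_def)
  then have "ennreal (expect t S (\<lambda>s. of_bool (snd s = Some b)))
      = emeasure (dist t S) {s. snd s = Some b}"
    by (simp add: measure_pmf.emeasure_eq_measure)
  also have "\<dots> \<le> emeasure (dist t S) {s. snd s \<noteq> None \<and> snd s \<noteq> Some (TH n k (\<lambda>i. i \<in> S))}"
    using assms by (intro emeasure_mono) (auto simp: TH_set)
  also have "\<dots> \<le> error_prob p n k A (\<lambda>i. i \<in> S)"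
    unfolding error_prob_def by (rule SUP_upper) simp
  also have "\<dots> \<le> worst_error p n k A"
    unfolding worst_error_def using assms set_in_inputs finite_inputs by (intro Max_ge) auto
  finally show ?thesis .
qed

lemma expect_length_le:
  assumes "0 \<le> B" "expected_queries p A (\<lambda>i. i \<in> S) \<le> ennreal B"
  shows "expect t S (\<lambda>s. real (length (fst s))) \<le> B"
proof -
  have "ennreal (expect t S (\<lambda>s. real (length (fst s))))
      = (\<integral>\<^sup>+ s. ennreal (real (length (fst s))) \<partial>dist t S)"
    by (rule nn_integral_eq_integral[symmetric]) auto
  also have "\<dots> \<le> expected_queries p A (\<lambda>i. i \<in> S)"
    unfolding expected_queries_def by (rule SUP_upper) simp
  finally show ?thesis using assms by (metis ennreal_le_iff order_trans)
qed

end

section \<open>Constants for a fixed \<open>e\<close>\<close>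

lemma worst_error_lower_bound:
  fixes e \<delta> p :: real
  assumes p: "0 < p" "p < 1/2" and e: "0 < e" "e < 1" and k: "1 \<le> k" "k \<le> n"
    and kn: "real k \<le> e / 8 * n"
    and \<delta>: "0 < \<delta>" "\<delta> \<le> e / 32" "\<delta> powr (e / 2) \<le> (e / 4)\<^sup>2 / 2" "32 / e \<le> (1 - e / 2) * ln (1 / \<delta>)"
    and A: "valid_policy n A"
    and Q: "\<forall>x\<in>inputs n. expected_queries p A x \<le> ennreal ((1 - e) * n * ln (k / \<delta>) / KL p)"
  shows "ennreal \<delta> \<le> worst_error p n k A"
\<comment> \<open>Assuming error below \<open>\<delta>\<close> everywhere bounds the probability of
  True on inputs with \<open>k - 1\<close> ones; the contradiction then comes from an input with
  \<open>k\<close> ones.\<close>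
proof (rule ccontr)
  assume "\<not> ennreal \<delta> \<le> worst_error p n k A"
  then have small: "worst_error p n k A < ennreal \<delta>" by simp
  interpret noisy_algorithm p n A using p A by unfold_locales
  define L where "L = ln (k / \<delta>)"
  \<comment> \<open>The threshold lies between the budget \<open>(1 - e) * L\<close> and
    \<open>L\<close>: the lower gap gives slack in Markov's inequality, the upper one a factor
    \<open>\<delta> powr (e / 2)\<close> at the end.\<close>
  define a where "a = (1 - e / 2) * L"
  define B where "B = (1 - e) * n * L / KL p"
  define t where "t = nat \<lceil>B * 32 / e\<rceil> + 1"
  define m where "m = k - 1"
  have m: "Suc m = k" using k by (simp add: m_def)
  have KL: "0 < KL p" unfolding KL_def using p by (intro mult_pos_pos ln_gt_zero) auto
  have "ln (1 / \<delta>) \<le> L"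
    unfolding L_def using k \<delta> by (intro ln_mono divide_right_mono) auto
  then have a32: "32 / e \<le> a"
    using \<delta>(4) e mult_left_mono[of "ln (1/\<delta>)" L "1 - e/2"] unfolding a_def by linarith
  have a: "0 < a" using a32 e by (smt (verit) divide_pos_pos)
  then have L: "0 < L" unfolding a_def using e by (simp add: zero_less_mult_iff)
  have B: "0 \<le> B" unfolding B_def using e L KL by simp
  have t: "0 < t" "B / t \<le> e / 32"
  proof -
    have "B * 32 / e \<le> t" unfolding t_def by linarith
    then show "B / t \<le> e / 32" using e by (simp add: t_def field_simps)
  qed (simp add: t_def)
  have a1: "1 / a \<le> e / 32" using a a32 e by (simp add: field_simps)
  have KB: "KL p * B / a \<le> (1 - e / 2) * n"
  proof -
    have "KL p * B / a = (1 - e) / (1 - e / 2) * n"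
      unfolding B_def a_def using KL L e by (simp add: field_simps)
    also have "\<dots> \<le> (1 - e / 2) * n"
    proof (intro mult_right_mono)
      \<comment> \<open>The square of \<open>1 - e / 2\<close> exceeds \<open>1 - e\<close> by
        \<open>e^2 / 4\<close>.\<close>
      show "(1 - e) / (1 - e / 2) \<le> 1 - e / 2"
        using e by (simp add: pos_divide_le_eq) (simp add: algebra_simps)
    qed simp
    finally show ?thesis .
  qed
  obtain S where S: "S \<subseteq> {..<n}" "card S = Suc m"
    "(e / 4)\<^sup>2 / (1 + exp a / Suc m) \<le> expect t S (\<lambda>s. of_bool (snd s = Some False))"
  proof (rule exists_input_accepting_zero)
    show "Suc m \<le> n" "0 < t" "0 < a" "0 < e / 4" using m k t a e by auto
    show "expect t S (\<lambda>s. real (length (fst s))) \<le> B" if "S \<subseteq> {..<n}" for S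
      using Q set_in_inputs[OF that] B unfolding B_def L_def by (intro expect_length_le) auto
    show "expect t T (\<lambda>s. of_bool (snd s = Some True)) \<le> \<delta>" if "T \<subseteq> {..<n}" "card T = m" for T
    proof -
      have "ennreal (expect t T (\<lambda>s. of_bool (snd s = Some True))) < ennreal \<delta>"
        using expect_le_worst_error[of T True k t] that m small by (auto intro: le_less_trans)
      then show ?thesis using \<delta> by (simp add: ennreal_less_iff)
    qed
    have nm: "real (n - m) = real n - real m" "m \<le> n" "real m \<le> e / 8 * n" using m k kn by auto
    \<comment> \<open>Of the slack \<open>e / 2\<close>, the constant \<open>c = e / 4\<close> and
      three losses of \<open>e / 32\<close> leave \<open>5 * e / 32\<close>, enough to absorb
      \<open>m \<le> e / 8 * n\<close>.\<close>
    have "(n - m) * (e / 4) + (1 - e / 2) * n \<le> (n - m) * (1 - 3 * e / 32)"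
    proof -
      have "real m * (1 - 11 * e / 32) \<le> real m * 1"
        using e by (intro mult_left_mono) auto
      also have "\<dots> \<le> n * (5 * e / 32)"
        using nm(3) e mult_nonneg_nonneg[of e "real n"] by (simp add: field_simps)
      finally have "0 \<le> n * (5 * e / 32) - m * (1 - 11 * e / 32)" by simp
      also have "\<dots> = (n - m) * (1 - 3 * e / 32) - ((n - m) * (e / 4) + (1 - e / 2) * n)"
        unfolding nm(1) by (simp add: field_simps)
      finally show ?thesis by simp
    qed
    also have "\<dots> \<le> (n - m) * (1 - \<delta> - B / t - 1 / a)"
      using \<delta>(2) t(2) a1 by (intro mult_left_mono) auto
    finally show "e / 4 * (n - m) \<le> (n - m) * (1 - \<delta> - B / t - 1 / a) - KL p * B / a"
      using KB by (simp add: mult.commute)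
  qed
  have "\<delta> \<le> (e / 4)\<^sup>2 / (1 + exp a / Suc m)"
  proof -
    \<comment> \<open>The part of \<open>exp a\<close> depending on \<open>k\<close> is at most
      \<open>k\<close> and cancels against \<open>Suc m\<close>, so
      \<open>exp a / Suc m \<le> D\<close>.\<close>
    define D where "D = \<delta> powr - (1 - e / 2)"
    have d1: "\<delta> \<le> 1" using \<delta>(2) e by simp
    have "D \<ge> 1"
      using powr_mono'[of "- (1 - e / 2)" 0 \<delta>] d1 \<delta>(1) e by (simp add: D_def)
    have "exp a = (k / \<delta>) powr (1 - e / 2)"
      unfolding a_def L_def powr_def using k \<delta> by simp
    also have "\<dots> = real k powr (1 - e / 2) * D"
      unfolding D_def using \<delta> by (simp add: powr_divide powr_minus field_simps)
    also have "\<dots> \<le> real k powr 1 * D"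
      using k e by (intro mult_right_mono powr_mono) (auto simp: D_def)
    finally have "exp a / Suc m \<le> D" using k m by (simp add: field_simps)
    then have "\<delta> * (1 + exp a / Suc m) \<le> \<delta> * (2 * D)"
      using \<open>D \<ge> 1\<close> \<delta> by (intro mult_left_mono) auto
    also have "\<dots> = 2 * (\<delta> powr 1 * \<delta> powr - (1 - e / 2))" using \<delta> by (simp add: D_def)
    also have "\<dots> = 2 * \<delta> powr (e / 2)" by (simp only: powr_add[symmetric]) simp
    also have "\<dots> \<le> (e / 4)\<^sup>2" using \<delta>(3) by simp
    finally show ?thesis by (simp add: pos_le_divide_eq add_pos_pos)
  qed
  with S(3) have "ennreal \<delta> \<le> ennreal (expect t S (\<lambda>s. of_bool (snd s = Some False)))"
    by (intro ennreal_leI) linarith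
  also have "\<dots> \<le> worst_error p n k A"
    using S m by (intro expect_le_worst_error) auto
  finally show False using small by simp
qed

theorem theorem1:
  fixes p :: real and k :: "nat \<Rightarrow> nat" and \<delta> :: "nat \<Rightarrow> real"
  assumes "0 < p" and "p < 1/2"
    and "\<forall>n. 1 \<le> k n" and "\<forall>n. 0 < \<delta> n"
    and "(\<lambda>n. real (k n)) \<in> o(\<lambda>n. real n)"
    and "\<delta> \<longlonglongrightarrow> 0"
  shows "\<exists>\<epsilon> :: nat \<Rightarrow> real. \<epsilon> \<longlonglongrightarrow> 0 \<and>
    (\<forall>\<^sub>F n in sequentially. \<forall>A. valid_policy n A \<longrightarrow>
       (\<forall>x\<in>inputs n. expected_queries p A x
           \<le> ennreal ((1 - \<epsilon> n) * real n * ln (real (k n) / \<delta> n) / KL p)) \<longrightarrow>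
       ennreal (\<delta> n) \<le> worst_error p n (k n) A)"
proof (rule diagonal_null_sequence)
  fix e :: real assume e: "0 < e" "e < 1"
  \<comment> \<open>The smallness conditions on \<open>\<delta>\<close> are proved near 0 from the
    right and pulled back along the sequence.\<close>
  have \<delta>0: "filterlim \<delta> (at_right 0) sequentially"
    using assms(4,6) by (simp add: filterlim_at less_imp_neq[THEN not_sym])
  have "\<forall>\<^sub>F d in at_right (0::real). d < e / 32"
    using e by (intro eventually_at_rightI[of 0 "e / 32"]) auto
  note ev1 = eventually_compose_filterlim[OF this \<delta>0]
  have "((\<lambda>d::real. d powr (e / 2)) \<longlongrightarrow> 0) (at_right 0)"
    using e by real_asymp
  then have "\<forall>\<^sub>F d in at_right 0. d powr (e / 2) < (e / 4)\<^sup>2 / 2"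
    by (rule order_tendstoD) (use e in auto)
  note ev2 = eventually_compose_filterlim[OF this \<delta>0]
  have "0 < 1 - e / 2" using e by simp
  then have "filterlim (\<lambda>d::real. (1 - e / 2) * ln (1 / d)) at_top (at_right 0)"
    by real_asymp
  then have "\<forall>\<^sub>F d in at_right 0. 32 / e \<le> (1 - e / 2) * ln (1 / d)"
    unfolding filterlim_at_top by blast
  note ev3 = eventually_compose_filterlim[OF this \<delta>0]
  have "\<forall>\<^sub>F n in sequentially. norm (real (k n)) \<le> e / 8 * norm (real n)"
    using assms(5) e by (intro landau_o.smallD) auto
  moreover note ev1 ev2 ev3
  ultimately show "\<forall>\<^sub>F n in sequentially. \<forall>A. valid_policy n A \<longrightarrow>
       (\<forall>x\<in>inputs n. expected_queries p A x
           \<le> ennreal ((1 - e) * real n * ln (real (k n) / \<delta> n) / KL p)) \<longrightarrow>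
       ennreal (\<delta> n) \<le> worst_error p n (k n) A"
  proof eventually_elim
    case (elim n)
    \<comment> \<open>This guarantees that inputs with \<open>k n\<close> ones exist.\<close>
    have "real (k n) \<le> 1 * n"
      using elim(1) e mult_right_mono[of "e / 8" 1 "real n"] by simp
    then show ?case
      using elim e assms by (intro allI impI worst_error_lower_bound) auto
  qed
qed

end
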